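(* Let $C\subset\mathbb{R}^n$ be a closed convex set and let $f:\mathbb{R}^n\to\mathbb{R}$ be continuously differentiable. Assume that there is $L>0$ with $\|\nabla f(x)-\nabla f(y)\|\le L\|x-y\|$ for all $x,y\in C$, and that $\nabla f(x)\in \mathrm{int}(C_\infty)^*$ for all $x\in C$. Let $(x^k)_{k\in\mathbb{N}}\subset C$ be an infinite sequence generated by the Frank--Wolfe algorithm for minimizing $f$ over $C$ (with the step size using this $L$, as described in the context), started from a point $x^0\in C$. Then each limit point $\bar x\in C$ of $(x^k)_{k\in\mathbb{N}}$ is a stationary point of the problem of minimizing $f$ over $C$, that is, $\nabla f(\bar x)^T(x-\bar x)\ge 0$ for all $x\in C$.
   Context: $\|\cdot\|$ is the Euclidean norm on $\mathbb{R}^n$. For a closed convex set $C\subset\mathbb{R}^n$, the asymptotic cone is $C_\infty:=\{d\in\mathbb{R}^n:\ x+td\in C\ \ \forall x\in C,\ \forall t\ge 0\}$ (equivalently, the set of all $d=\lim_k t_k x^k$ with $x^k\in C$, $t_k>0$, $t_k\to 0$), and $\mathrm{int}(C_\infty)^*:=\{x\in\mathbb{R}^n:\ x^Ty>0\ \ \forall y\in C_\infty\setminus\{0\}\}$ is the interior of the positive dual cone of $C_\infty$. Frank--Wolfe algorithm: choose $x^0\in C$. Given $x^k\in C$, choose any $p^k\in\operatorname{argmin}_{p\in C}\nabla f(x^k)^T(p-x^k)$ and set $v_k^*:=\nabla f(x^k)^T(p^k-x^k)$. If $v_k^*=0$, stop. Otherwise set $\lambda_k:=\min\{1,\ |v_k^*|/(L\|p^k-x^k\|^2)\}$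 and $x^{k+1}:=x^k+\lambda_k(p^k-x^k)$. Under the stated assumptions the argmin is nonempty for every $x^k\in C$. The generated sequence is infinite when the algorithm never stops, i.e. $v_k^*\ne 0$ for all $k$. *)

theory Defs
  imports "HOL-Analysis.Analysis"
begin

definition asymptotic_cone :: "(real ^ 'n) set \<Rightarrow> (real ^ 'n) set" where
  "asymptotic_cone C = {d. \<forall>x\<in>C. \<forall>t\<ge>0. x + t *\<^sub>R d \<in> C}"

text \<open>
  For a nonempty closed cone \<open>K\<close>, this set is the interior of the positive dual cone of \<open>K\<close>;
  for other \<open>K\<close> it need not be.
\<close>

definition int_dual_cone :: "(real ^ 'n) set \<Rightarrow> (real ^ 'n) set" where
  "int_dual_cone K = {x. \<forall>y\<in>K - {0}. x \<bullet> y > 0}"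

definition fw_value :: "(real ^ 'n \<Rightarrow> real ^ 'n) \<Rightarrow> real ^ 'n \<Rightarrow> real ^ 'n \<Rightarrow> real" where
  "fw_value g x p = g x \<bullet> (p - x)"

definition fw_stepsize ::
  "(real ^ 'n \<Rightarrow> real ^ 'n) \<Rightarrow> real \<Rightarrow> real ^ 'n \<Rightarrow> real ^ 'n \<Rightarrow> real" where
  "fw_stepsize g L x p = min 1 (\<bar>fw_value g x p\<bar> / (L * (norm (p - x))\<^sup>2))"

text \<open>
  The argument \<open>g\<close> is the gradient of the objective function. The condition
  \<open>fw_value g (x k) (p k) \<noteq> 0\<close> says that the stopping test fails at every iteration,
  so that the algorithm generates an infinite sequence. Since the minimisers \<open>p k\<close> need not be
  unique, \<open>x\<close> is generated by the algorithm if some choice of minimisers produces it.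
\<close>

definition infinite_frank_wolfe_sequence ::
  "(real ^ 'n) set \<Rightarrow> (real ^ 'n \<Rightarrow> real ^ 'n) \<Rightarrow> real \<Rightarrow> (nat \<Rightarrow> real ^ 'n) \<Rightarrow> bool" where
  "infinite_frank_wolfe_sequence C g L x \<longleftrightarrow>
     x 0 \<in> C \<and>
     (\<exists>p. \<forall>k. is_arg_min (fw_value g (x k)) (\<lambda>q. q \<in> C) (p k) \<and>
              fw_value g (x k) (p k) \<noteq> 0 \<and>
              x (Suc k) = x k + fw_stepsize g L (x k) (p k) *\<^sub>R (p k - x k))"

text \<open>
  Limit points of a sequence are limits of subsequences; this differs from \<open>islimpt\<close> for
  the range of the sequence, which misses values taken infinitely often.
\<close>

definition seq_limit_point :: "(nat \<Rightarrow> 'a::topological_space) \<Rightarrow> 'a \<Rightarrow> bool" where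
  "seq_limit_point x z \<longleftrightarrow> (\<exists>r. strict_mono r \<and> (x \<circ> r) \<longlonglongrightarrow> z)"

definition stationary_point ::
  "(real ^ 'n) set \<Rightarrow> (real ^ 'n \<Rightarrow> real ^ 'n) \<Rightarrow> real ^ 'n \<Rightarrow> bool" where
  "stationary_point C g z \<longleftrightarrow> z \<in> C \<and> (\<forall>x\<in>C. g z \<bullet> (x - z) \<ge> 0)"

end

theory Submission
  imports Defs
begin

text \<open>
  The step size is the one for which the descent lemma gives
  \<open>f x\<^sub>k\<^sub>+\<^sub>1 \<le> f x\<^sub>k - \<lambda>\<^sub>k \<bar>v\<^sub>k\<bar> / 2\<close>. The values \<open>f x\<^sub>k\<close> are therefore monotone and, since they
  converge along the subsequence tending to \<open>z\<close>, they converge, whence \<open>\<lambda>\<^sub>k \<bar>v\<^sub>k\<bar> \<rightarrow> 0\<close>.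
  Along the subsequence the directions \<open>p\<^sub>k - x\<^sub>k\<close> stay bounded: otherwise their normalisations
  would accumulate at a unit vector \<open>d\<close> of the asymptotic cone, and \<open>v\<^sub>k \<le> 0\<close> would give
  \<open>g z \<bullet> d \<le> 0\<close>. Bounded directions and \<open>\<lambda>\<^sub>k \<bar>v\<^sub>k\<bar> \<rightarrow> 0\<close> force \<open>v\<^sub>k \<rightarrow> 0\<close>, and stationarity
  is the limit of the minimality of \<open>p\<^sub>k\<close>.
\<close>

text \<open>Along the segment from \<open>x\<close> to \<open>x + d\<close> the derivative of
  \<open>f\<close> exceeds \<open>g x \<bullet> d\<close> by at most
  \<open>L * t * (norm d)\<^sup>2\<close>, by Cauchy-Schwarz and the Lipschitz bound. That bound
  holds only on \<open>C\<close>; convexity keeps the segment inside.\<close>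

lemma descent_lemma:
  fixes f :: "'a::real_inner \<Rightarrow> real"
  assumes "convex C" "x \<in> C" "x + d \<in> C"
    and grad: "\<And>y. GDERIV f y :> g y"
    and lip: "\<And>y w. y \<in> C \<Longrightarrow> w \<in> C \<Longrightarrow> norm (g y - g w) \<le> L * norm (y - w)"
  shows "f (x + d) \<le> f x + g x \<bullet> d + L / 2 * (norm d)\<^sup>2"
proof -
  \<comment> \<open>The quadratic upper model without its constant \<open>f x\<close> is subtracted
    from \<open>f\<close>, so the claim is exactly \<open>h 1 \<le> h 0\<close>.\<close>
  define h where "h t = f (x + t *\<^sub>R d) - t * (g x \<bullet> d) - L / 2 * t\<^sup>2 * (norm d)\<^sup>2" for t :: real
  have "\<exists>D. (h has_real_derivative D) (at t) \<and> D \<le> 0" if t: "0 \<le> t" "t \<le> 1" for t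
  proof (intro exI conjI)
    have "(f has_derivative (\<lambda>u. u \<bullet> g (x + t *\<^sub>R d))) (at (x + t *\<^sub>R d))"
      using grad by (simp add: gderiv_def)
    moreover have "((\<lambda>t. x + t *\<^sub>R d) has_derivative (\<lambda>s. s *\<^sub>R d)) (at t)"
      by (auto intro!: derivative_eq_intros)
    ultimately have "((\<lambda>t. f (x + t *\<^sub>R d)) has_derivative (\<lambda>s. (s *\<^sub>R d) \<bullet> g (x + t *\<^sub>R d))) (at t)"
      using has_derivative_compose by blast
    then have "((\<lambda>t. f (x + t *\<^sub>R d)) has_real_derivative (g (x + t *\<^sub>R d) \<bullet> d)) (at t)"
      by (simp add: has_field_derivative_def inner_commute mult_commute_abs)
    then show "(h has_real_derivative
        (g (x + t *\<^sub>R d) \<bullet> d - g x \<bullet> d - L * t * (norm d)\<^sup>2)) (at t)"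
      unfolding h_def by (auto intro!: derivative_eq_intros)
    have "x + t *\<^sub>R d = (1 - t) *\<^sub>R x + t *\<^sub>R (x + d)"
      by (simp add: algebra_simps)
    then have "x + t *\<^sub>R d \<in> C"
      using assms(1-3) t by (simp add: convexD)
    then have "norm (g (x + t *\<^sub>R d) - g x) \<le> L * (t * norm d)"
      using lip[of "x + t *\<^sub>R d" x] t \<open>x \<in> C\<close> by simp
    then have "norm (g (x + t *\<^sub>R d) - g x) * norm d \<le> L * (t * norm d) * norm d"
      by (rule mult_right_mono) simp
    then have "(g (x + t *\<^sub>R d) - g x) \<bullet> d \<le> L * (t * norm d) * norm d"
      using norm_cauchy_schwarz order_trans by blast
    then show "g (x + t *\<^sub>R d) \<bullet> d - g x \<bullet> d - L * t * (norm d)\<^sup>2 \<le> 0"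
      by (simp add: inner_diff_left power2_eq_square mult.assoc)
  qed
  then have "h 1 \<le> h 0"
    by (intro DERIV_nonpos_imp_nonincreasing[of 0 1 h]) auto
  then show ?thesis
    by (simp add: h_def)
qed

text \<open>Each \<open>y + t *\<^sub>R d\<close> is a limit of points on the segments from
  \<open>y\<close> to \<open>p k\<close>: the weight of \<open>p k\<close>, namely \<open>t\<close>
  divided by the norm of \<open>p k - x k\<close>, tends to 0 and so eventually lies in
  [0,1].\<close>

lemma asymptotic_coneI_limit:
  fixes C :: "(real ^ 'n) set"
  assumes "closed C" "convex C" and p: "\<And>k. p k \<in> C"
    and "x \<longlonglongrightarrow> z"
    and inf: "filterlim (\<lambda>k. norm (p k - x k)) at_top sequentially"
    and lim: "(\<lambda>k. (p k - x k) /\<^sub>R norm (p k - x k)) \<longlonglongrightarrow> d"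
  shows "d \<in> asymptotic_cone C"
  unfolding asymptotic_cone_def
proof (intro CollectI ballI allI impI)
  fix y and t :: real
  assume y: "y \<in> C" and "0 \<le> t"
  define n where "n k = norm (p k - x k)" for k
  have inv: "(\<lambda>k. inverse (n k)) \<longlonglongrightarrow> 0"
    unfolding n_def by (rule tendsto_inverse_0_at_top[OF inf])
  \<comment> \<open>The base point moves from \<open>x k\<close> to \<open>y\<close>. The correction
    vanishes because \<open>x k\<close> converges while \<open>n k\<close> tends to infinity, and it
    turns the expression into a combination of \<open>y\<close> and \<open>p k\<close>.\<close>
  have "(\<lambda>k. y + t *\<^sub>R ((p k - x k) /\<^sub>R n k + inverse (n k) *\<^sub>R (x k - y)))
      \<longlonglongrightarrow> y + t *\<^sub>R (d + 0 *\<^sub>R (z - y))"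
    using lim unfolding n_def[symmetric]
    by (intro tendsto_intros inv assms(4))
  moreover have "y + t *\<^sub>R ((p k - x k) /\<^sub>R n k + inverse (n k) *\<^sub>R (x k - y))
      = (1 - t * inverse (n k)) *\<^sub>R y + (t * inverse (n k)) *\<^sub>R p k" for k
    by (simp add: algebra_simps)
  ultimately have *: "(\<lambda>k. (1 - t * inverse (n k)) *\<^sub>R y + (t * inverse (n k)) *\<^sub>R p k)
      \<longlonglongrightarrow> y + t *\<^sub>R d"
    by simp
  have "(\<lambda>k. t * inverse (n k)) \<longlonglongrightarrow> t * 0"
    by (intro tendsto_intros inv)
  then have "\<forall>\<^sub>F k in sequentially. t * inverse (n k) < 1"
    by (intro order_tendstoD(2)) auto
  then have "\<forall>\<^sub>F k in sequentially.
      (1 - t * inverse (n k)) *\<^sub>R y + (t * inverse (n k)) *\<^sub>R p k \<in> C"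
  proof (eventually_elim)
    case (elim k)
    moreover have "0 \<le> t * inverse (n k)"
      using \<open>0 \<le> t\<close> by (simp add: n_def)
    ultimately show ?case
      using \<open>convex C\<close> y p by (intro convexD) auto
  qed
  then show "y + t *\<^sub>R d \<in> C"
    using Lim_in_closed_set[OF \<open>closed C\<close> _ _ *] by simp
qed

lemma descent_directions_eventually_bounded:
  fixes C :: "(real ^ 'n) set"
  assumes "closed C" "convex C" and p: "\<And>k. p k \<in> C"
    and x: "x \<longlonglongrightarrow> z" and h: "h \<longlonglongrightarrow> h'"
    and h': "h' \<in> int_dual_cone (asymptotic_cone C)"
    and nonpos: "\<And>k. h k \<bullet> (p k - x k) \<le> 0"
  shows "\<exists>M. \<forall>\<^sub>F k in sequentially. norm (p k - x k) \<le> M"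
proof (rule ccontr)
  assume "\<nexists>M. \<forall>\<^sub>F k in sequentially. norm (p k - x k) \<le> M"
  then have "\<forall>n. \<exists>k\<ge>n. real n < norm (p k - x k)"
    unfolding eventually_sequentially by (metis not_le)
  \<comment> \<open>\<open>s\<close> need not be monotone: \<open>s n \<ge> n\<close> already makes
    it tend to infinity.\<close>
  then obtain s where s: "\<And>n. s n \<ge> n" "\<And>n. real n < norm (p (s n) - x (s n))"
    by metis
  define u where "u n = (p (s n) - x (s n)) /\<^sub>R norm (p (s n) - x (s n))" for n
  have s_lim: "filterlim s at_top sequentially"
    by (rule filterlim_at_top_mono[OF filterlim_ident]) (simp add: s)
  have norm_lim: "filterlim (\<lambda>n. norm (p (s n) - x (s n))) at_top sequentially"
    by (rule filterlim_at_top_mono[OF filterlim_real_sequentially])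
      (simp add: s less_imp_le)
  have norm_u: "norm (u n) = 1" for n
  proof -
    have "norm (p (s n) - x (s n)) \<noteq> 0"
      using s(2)[of n] by linarith
    then show ?thesis
      by (simp add: u_def)
  qed
  then have "\<forall>n. u n \<in> sphere 0 1"
    by simp
  then obtain d r where d: "d \<in> sphere 0 1" and r: "strict_mono r" "(u \<circ> r) \<longlonglongrightarrow> d"
    using compact_sphere[of "0::real^'n" 1] unfolding compact_def by metis
  have r_lim: "filterlim r at_top sequentially"
    by (rule filterlim_subseq[OF r(1)])
  have sr_lim: "filterlim (\<lambda>k. s (r k)) at_top sequentially"
    by (rule filterlim_compose[OF s_lim r_lim])
  have "d \<in> asymptotic_cone C"
  proof (rule asymptotic_coneI_limit[OF \<open>closed C\<close> \<open>convex C\<close>])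
    show "(\<lambda>k. x (s (r k))) \<longlonglongrightarrow> z"
      by (rule filterlim_compose[OF x sr_lim])
    show "filterlim (\<lambda>k. norm (p (s (r k)) - x (s (r k)))) at_top sequentially"
      by (rule filterlim_compose[OF norm_lim r_lim])
    show "(\<lambda>k. (p (s (r k)) - x (s (r k))) /\<^sub>R norm (p (s (r k)) - x (s (r k)))) \<longlonglongrightarrow> d"
      using r(2) by (simp add: u_def o_def)
  qed (rule p)
  moreover have "d \<noteq> 0"
    using d by auto
  ultimately have "h' \<bullet> d > 0"
    using h' by (simp add: int_dual_cone_def)
  moreover have "(\<lambda>k. h (s (r k)) \<bullet> u (r k)) \<longlonglongrightarrow> h' \<bullet> d"
    using r(2) filterlim_compose[OF h sr_lim] by (intro tendsto_inner) (auto simp: o_def)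
  \<comment> \<open>Normalising multiplies by a nonnegative factor, so the sign in
    \<open>nonpos\<close> survives in the limit and contradicts the strict positivity on the
    asymptotic cone.\<close>
  then have "h' \<bullet> d \<le> 0"
    by (rule tendsto_upperbound)
      (auto intro!: always_eventually mult_nonneg_nonpos nonpos simp: u_def)
  ultimately show False
    by simp
qed

lemma fw_step_in:
  assumes "convex C" "L > 0" "x \<in> C" "p \<in> C"
  shows "x + fw_stepsize g L x p *\<^sub>R (p - x) \<in> C"
proof -
  let ?l = "fw_stepsize g L x p"
  have "0 \<le> ?l" "?l \<le> 1"
    using \<open>L > 0\<close> by (auto simp: fw_stepsize_def)
  then have "(1 - ?l) *\<^sub>R x + ?l *\<^sub>R p \<in> C"
    using assms by (intro convexD) auto
  then show ?thesis
    by (simp add: algebra_simps)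
qed

text \<open>The step size \<open>l\<close> satisfies
  \<open>l * (L * (norm (p - x))\<^sup>2) \<le> \<bar>v\<bar>\<close>, so the quadratic term of the
  descent lemma consumes at most half of the linear gain \<open>l * \<bar>v\<bar>\<close>.\<close>

lemma fw_step_decrease:
  assumes "convex C" "L > 0" "x \<in> C" "p \<in> C"
    and "\<And>y. GDERIV f y :> g y"
    and "\<And>y w. y \<in> C \<Longrightarrow> w \<in> C \<Longrightarrow> norm (g y - g w) \<le> L * norm (y - w)"
    and v: "fw_value g x p < 0"
  shows "f (x + fw_stepsize g L x p *\<^sub>R (p - x))
    \<le> f x - fw_stepsize g L x p * \<bar>fw_value g x p\<bar> / 2"
proof -
  define l where "l = fw_stepsize g L x p"
  define v where "v = fw_value g x p"
  have "p \<noteq> x"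
    using v by (auto simp: fw_value_def)
  then have pos: "L * (norm (p - x))\<^sup>2 > 0"
    using \<open>L > 0\<close> by simp
  have "0 \<le> l"
    using pos by (simp add: l_def fw_stepsize_def)
  have "l \<le> \<bar>v\<bar> / (L * (norm (p - x))\<^sup>2)"
    by (simp add: l_def v_def fw_stepsize_def)
  then have "l * (L * (norm (p - x))\<^sup>2) \<le> \<bar>v\<bar>"
    using pos by (simp add: pos_le_divide_eq)
  then have "l * (l * (L * (norm (p - x))\<^sup>2)) \<le> l * \<bar>v\<bar>"
    using \<open>0 \<le> l\<close> by (rule mult_left_mono)
  then have "L / 2 * (norm (l *\<^sub>R (p - x)))\<^sup>2 \<le> l * \<bar>v\<bar> / 2"
    by (simp add: power_mult_distrib power2_eq_square mult_ac)
  moreover have "g x \<bullet> (l *\<^sub>R (p - x)) = - (l * \<bar>v\<bar>)"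
    using v by (simp add: v_def fw_value_def)
  moreover have "f (x + l *\<^sub>R (p - x))
      \<le> f x + g x \<bullet> (l *\<^sub>R (p - x)) + L / 2 * (norm (l *\<^sub>R (p - x)))\<^sup>2"
    using assms fw_step_in[OF assms(1-4)] unfolding l_def by (intro descent_lemma) auto
  ultimately show ?thesis
    unfolding l_def v_def by linarith
qed

text \<open>A full step gives \<open>v = w\<close>; a short one gives
  \<open>v\<^sup>2 = w * n\<close> with \<open>n\<close> at most \<open>L * M\<^sup>2\<close>. The
  sum of both bounds covers either case, so the limit argument need not know which steps are
  full.\<close>

lemma fw_value_bound:
  fixes g :: "real ^ 'n \<Rightarrow> real ^ 'n"
  assumes "L > 0" "norm (p - x) \<le> M"
  defines "w \<equiv> fw_stepsize g L x p * \<bar>fw_value g x p\<bar>"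
  shows "\<bar>fw_value g x p\<bar> \<le> w + sqrt (w * (L * M\<^sup>2))"
proof -
  define v where "v = \<bar>fw_value g x p\<bar>"
  define n where "n = L * (norm (p - x))\<^sup>2"
  have "0 \<le> v" "0 \<le> n"
    using \<open>L > 0\<close> by (simp_all add: v_def n_def)
  have w: "w = min 1 (v / n) * v"
    by (simp add: w_def v_def n_def fw_stepsize_def)
  then have "0 \<le> w"
    using \<open>0 \<le> v\<close> \<open>0 \<le> n\<close> by simp
  show ?thesis
  proof (cases "1 \<le> v / n")
    case True
    then show ?thesis
      using w \<open>0 \<le> w\<close> \<open>L > 0\<close> by (simp add: v_def)
  next
    case False
    show ?thesis
    \<comment> \<open>Since division by zero yields 0, the degenerate case \<open>p = x\<close>
      falls under the short step.\<close>
    proof (cases "n = 0")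
      case True
      then have "p = x"
        using \<open>L > 0\<close> by (simp add: n_def)
      then show ?thesis
        using \<open>0 \<le> w\<close> \<open>L > 0\<close> by (simp add: fw_value_def)
    next
      case n0: False
      then have "v\<^sup>2 = w * n"
        using False w by (simp add: power2_eq_square)
      also have "\<dots> \<le> w * (L * M\<^sup>2)"
        using assms(1,2) \<open>0 \<le> w\<close> unfolding n_def
        by (intro mult_left_mono power_mono) auto
      finally have "v \<le> sqrt (w * (L * M\<^sup>2))"
        by (rule real_le_rsqrt)
      then show ?thesis
        using \<open>0 \<le> w\<close> by (simp add: v_def)
    qed
  qed
qed

text \<open>Because \<open>r k \<ge> k\<close>, each \<open>a k\<close> is at least
  \<open>a (r k)\<close> and hence at least \<open>l\<close>. So \<open>a\<close> is bounded below
  and converges, necessarily to \<open>l\<close>.\<close>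

lemma decseq_convergent_subseq:
  fixes a :: "nat \<Rightarrow> real"
  assumes "decseq a" "strict_mono r" "(a \<circ> r) \<longlonglongrightarrow> l"
  shows "a \<longlonglongrightarrow> l"
proof -
  have "decseq (a \<circ> r)"
    using assms(1,2) by (simp add: decseq_def strict_mono_less_eq)
  have "l \<le> a k" for k
    using decseq_ge[OF \<open>decseq (a \<circ> r)\<close> assms(3), of k]
      decseqD[OF assms(1) seq_suble[OF assms(2), of k]] by simp
  then obtain m where "a \<longlonglongrightarrow> m"
    using decseq_convergent[OF assms(1)] by blast
  then show ?thesis
    using LIMSEQ_subseq_LIMSEQ[OF _ assms(2)] LIMSEQ_unique assms(3) by blast
qed

theorem theorem3p5:
  fixes C :: "(real ^ 'n) set"
    and f :: "real ^ 'n \<Rightarrow> real"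
    and g :: "real ^ 'n \<Rightarrow> real ^ 'n"
    and L :: real
    and x :: "nat \<Rightarrow> real ^ 'n"
    and z :: "real ^ 'n"
  assumes "closed C" and "convex C"
    and "\<And>y. GDERIV f y :> g y" and "continuous_on UNIV g"
    and "L > 0" and "\<And>y w. y \<in> C \<Longrightarrow> w \<in> C \<Longrightarrow> norm (g y - g w) \<le> L * norm (y - w)"
    and "\<And>y. y \<in> C \<Longrightarrow> g y \<in> int_dual_cone (asymptotic_cone C)"
    and "infinite_frank_wolfe_sequence C g L x"
    and "seq_limit_point x z"
  shows "stationary_point C g z"
proof -
  obtain p where "x 0 \<in> C"
    and argmin: "\<And>k. is_arg_min (fw_value g (x k)) (\<lambda>q. q \<in> C) (p k)"
    and v_nz: "\<And>k. fw_value g (x k) (p k) \<noteq> 0"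
    and step: "\<And>k. x (Suc k) = x k + fw_stepsize g L (x k) (p k) *\<^sub>R (p k - x k)"
    using assms(8) unfolding infinite_frank_wolfe_sequence_def by blast
  obtain r where r: "strict_mono r" "(x \<circ> r) \<longlonglongrightarrow> z"
    using assms(9) unfolding seq_limit_point_def by blast
  have p: "p k \<in> C" for k
    using argmin[of k] by (simp add: is_arg_min_def)
  have min: "fw_value g (x k) (p k) \<le> fw_value g (x k) q" if "q \<in> C" for k q
    using argmin[of k] that by (auto simp: is_arg_min_def not_less)
  have x: "x k \<in> C" for k
    by (induction k) (auto simp: step \<open>x 0 \<in> C\<close> intro!: fw_step_in assms p)
  \<comment> \<open>The iterate \<open>x k\<close> is itself a feasible competitor with value 0; the
    failed stopping test makes the inequality strict.\<close>
  have v_neg: "fw_value g (x k) (p k) < 0" for k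
    using min[OF x[of k], of k] v_nz[of k] by (simp add: fw_value_def)
  define w where "w k = fw_stepsize g L (x k) (p k) * \<bar>fw_value g (x k) (p k)\<bar>" for k
  have w_nonneg: "0 \<le> w k" for k
    using \<open>L > 0\<close> by (simp add: w_def fw_stepsize_def)
  have decrease: "f (x (Suc k)) \<le> f (x k) - w k / 2" for k
    unfolding step w_def using assms(2,3,5,6) x p v_neg by (intro fw_step_decrease) auto
  have z: "z \<in> C"
    using closed_sequentially[OF \<open>closed C\<close> _ r(2)] x by simp
  have xr: "(\<lambda>k. x (r k)) \<longlonglongrightarrow> z"
    using r(2) by (simp add: o_def)

  have "isCont f z"
    using assms(3)[of z] has_derivative_continuous unfolding gderiv_def by blast
  then have "((\<lambda>k. f (x k)) \<circ> r) \<longlonglongrightarrow> f z"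
    using isCont_tendsto_compose xr by (fastforce simp: o_def)
  moreover have "decseq (\<lambda>k. f (x k))"
    using decrease w_nonneg by (intro decseq_SucI) (smt (verit) field_sum_of_halves)
  ultimately have f_lim: "(\<lambda>k. f (x k)) \<longlonglongrightarrow> f z"
    using decseq_convergent_subseq r(1) by blast
  \<comment> \<open>Convergence of the whole sequence of values is used here:
    \<open>x (Suc k)\<close> need not belong to the subsequence even if \<open>x k\<close>
    does.\<close>
  have "(\<lambda>k. 2 * (f (x k) - f (x (Suc k)))) \<longlonglongrightarrow> 2 * (f z - f z)"
    by (intro tendsto_intros f_lim LIMSEQ_Suc)
  moreover have "w k \<le> 2 * (f (x k) - f (x (Suc k)))" for k
    using decrease[of k] by simp
  ultimately have "w \<longlonglongrightarrow> 0"
    by (intro tendsto_sandwich[where f = "\<lambda>_. 0" and g = w])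
      (use w_nonneg in auto)
  then have w_lim: "(\<lambda>k. w (r k)) \<longlonglongrightarrow> 0"
    using LIMSEQ_subseq_LIMSEQ[OF _ r(1)] by (simp add: o_def)

  have g_lim: "(\<lambda>k. g (x (r k))) \<longlonglongrightarrow> g z"
    using continuous_on_tendsto_compose[OF assms(4) xr] by simp
  \<comment> \<open>Since \<open>z\<close> lies in \<open>C\<close>, the limit gradient
    \<open>g z\<close> is positive on the nonzero asymptotic directions.\<close>
  obtain M where M: "\<forall>\<^sub>F k in sequentially. norm (p (r k) - x (r k)) \<le> M"
    using descent_directions_eventually_bounded[OF assms(1,2) p xr g_lim assms(7)[OF z]]
      v_neg unfolding fw_value_def by (meson less_imp_le)
  have "(\<lambda>k. w (r k) + sqrt (w (r k) * (L * M\<^sup>2))) \<longlonglongrightarrow> 0 + sqrt (0 * (L * M\<^sup>2))"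
    by (intro tendsto_intros w_lim)
  then have bound_lim: "(\<lambda>k. w (r k) + sqrt (w (r k) * (L * M\<^sup>2))) \<longlonglongrightarrow> 0"
    by simp
  have v_lim: "(\<lambda>k. fw_value g (x (r k)) (p (r k))) \<longlonglongrightarrow> 0"
    by (rule Lim_null_comparison[OF _ bound_lim], use M in eventually_elim)
      (use fw_value_bound[OF \<open>L > 0\<close>] in \<open>simp add: w_def\<close>)

  have "0 \<le> g z \<bullet> (q - z)" if q: "q \<in> C" for q
  \<comment> \<open>For fixed \<open>q\<close>, minimality of \<open>p (r k)\<close> bounds the
    value at \<open>q\<close> below by a sequence tending to 0.\<close>
  proof (rule tendsto_le[OF _ _ v_lim])
    show "(\<lambda>k. fw_value g (x (r k)) q) \<longlonglongrightarrow> g z \<bullet> (q - z)"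
      unfolding fw_value_def by (intro tendsto_intros g_lim xr)
  qed (use min[OF q] in auto)
  then show ?thesis
    using z by (simp add: stationary_point_def)
qed

end
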